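(* Let $k\ge 2$ be a constant. There are constants $c_1,c_2>0$ (depending only on $k$) such that for every $n$ and every $f\colon\{0,1\}^n\to\{0,1\}$ with $f\in R_k$, letting $\mathrm{CC}(f)$ be the communication complexity of the $R_k$-communication game for $f$ and $D(f)$ the minimal $d$ for which there exists a circuit $C\le f$ of depth $d$ consisting only of $\mathrm{THR}^{k+1}_2$ gates and literals, we have $c_1 D(f)\le \mathrm{CC}(f)\le c_2 D(f)$.
   Context: $R_k$ is the set of Boolean functions $f\colon\{0,1\}^n\to\{0,1\}$ such that for all $x^1,\dots,x^k\in f^{-1}(0)$ there is a coordinate $i$ with $x^1_i=\dots=x^k_i$. $\mathrm{THR}^{k+1}_2$ outputs $1$ iff at least $2$ of its $k+1$ input bits are $1$. A circuit consisting only of $\mathrm{THR}^{k+1}_2$ gates and literals is a directed acyclic graph with an output node, internal nodes being $\mathrm{THR}^{k+1}_2$ gates with $k+1$ ordered inputs, and input nodes labeled by literals $x_i$ or $\neg x_i$ (negations only on variables, no constants); depth is the maximal length of a path from the output node to an input node, negations in literals not counted. We write $C\le f$ if $C(x)=0$ for every $x\in f^{-1}(0)$. The $R_k$-communication game for $f$ is the $k$-party number-in-hand problem where party $j$ receives $x^j\in f^{-1}(0)$ and the parties must output a pair $(i,b)\in[n]\times\{0,1\}$ with $x^1_i=\dots=x^k_i=b$. Protocols are deterministic: at each step one party, depending on the communication so far and its own input, broadcasts one bit; the communication complexity is the minimum, over always-correct protocols, of the maximal number of bits communicated. *)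

theory Defs
  imports "HOL-Library.Extended_Real" "HOL-Library.FuncSet"
begin

section \<open>Boolean functions\<close>

text \<open>
  A Boolean function of \<open>n\<close> variables is represented by some \<open>f :: bool list \<Rightarrow> bool\<close>, of which only
  the values on lists of length \<open>n\<close> matter. Coordinates and parties are numbered from \<open>0\<close>.
\<close>

definition zeros :: "nat \<Rightarrow> (bool list \<Rightarrow> bool) \<Rightarrow> bool list set" where
  "zeros n f = {x. length x = n \<and> \<not> f x}"

definition zero_tuples :: "nat \<Rightarrow> nat \<Rightarrow> (bool list \<Rightarrow> bool) \<Rightarrow> (nat \<Rightarrow> bool list) set" where
  "zero_tuples k n f = {..<k} \<rightarrow>\<^sub>E zeros n f"

definition R :: "nat \<Rightarrow> nat \<Rightarrow> (bool list \<Rightarrow> bool) set" where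
  "R k n = {f. \<forall>xs \<in> zero_tuples k n f. \<exists>i<n. \<forall>j<k. \<forall>l<k. xs j ! i = xs l ! i}"


section \<open>Threshold circuits\<close>

definition THR :: "nat \<Rightarrow> bool list \<Rightarrow> bool" where
  "THR m bs \<longleftrightarrow> m \<le> count_list bs True"

text \<open>
  \<open>Lit i True\<close> is the literal \<open>x\<^sub>i\<close> and \<open>Lit i False\<close> its negation; \<open>Gate us\<close> is a gate whose ordered
  inputs are the nodes in \<open>us\<close>, where one node may feed several inputs.
\<close>

datatype node_label = Lit nat bool | Gate "nat list"

record circuit =
  nodes :: "nat set"
  label :: "nat \<Rightarrow> node_label"
  out :: nat

definition edges :: "circuit \<Rightarrow> (nat \<times> nat) set" where
  "edges C = {(v, u). v \<in> nodes C \<and> (\<exists>us. label C v = Gate us \<and> u \<in> set us)}"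

definition is_circuit :: "nat \<Rightarrow> nat \<Rightarrow> circuit \<Rightarrow> bool" where
  "is_circuit k n C \<longleftrightarrow>
     finite (nodes C) \<and> out C \<in> nodes C \<and> acyclic (edges C) \<and>
     (\<forall>v \<in> nodes C. case label C v of
        Lit i b \<Rightarrow> i < n
      | Gate us \<Rightarrow> length us = k + 1 \<and> set us \<subseteq> nodes C)"

inductive evaluates :: "circuit \<Rightarrow> bool list \<Rightarrow> nat \<Rightarrow> bool \<Rightarrow> bool"
  for C :: circuit and x :: "bool list" where
  Lit: "label C v = Lit i b \<Longrightarrow> evaluates C x v (x ! i = b)"
| Gate: "label C v = Gate us \<Longrightarrow> list_all2 (evaluates C x) us bs \<Longrightarrow> evaluates C x v (THR 2 bs)"

definition circuit_le :: "nat \<Rightarrow> circuit \<Rightarrow> (bool list \<Rightarrow> bool) \<Rightarrow> bool" where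
  "circuit_le n C f \<longleftrightarrow> (\<forall>x \<in> zeros n f. evaluates C x (out C) False)"

definition path_lengths :: "circuit \<Rightarrow> nat set" where
  "path_lengths C = {l. \<exists>v i b. (out C, v) \<in> edges C ^^ l \<and> label C v = Lit i b}"

definition depth :: "circuit \<Rightarrow> nat" where
  "depth C = Max (path_lengths C)"

text \<open>The value is \<open>\<infinity>\<close> if there is no such circuit, which for \<open>f \<in> R k n\<close> can only
  happen for \<open>n = 0\<close>.\<close>

definition min_depth :: "nat \<Rightarrow> nat \<Rightarrow> (bool list \<Rightarrow> bool) \<Rightarrow> enat" where
  "min_depth k n f = (INF C \<in> {C. is_circuit k n C \<and> circuit_le n C f}. enat (depth C))"


subsection \<open>Well-definedness of values and depth\<close>

lemma wf_edges:
  assumes "is_circuit k n C"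
  shows "wf ((edges C)\<inverse>)"
proof -
  have "edges C \<subseteq> nodes C \<times> nodes C"
  proof
    fix e assume "e \<in> edges C"
    then obtain v u us where e: "e = (v, u)" "v \<in> nodes C" "label C v = Gate us" "u \<in> set us"
      by (auto simp: edges_def)
    with assms have "set us \<subseteq> nodes C"
      by (fastforce simp: is_circuit_def)
    with e show "e \<in> nodes C \<times> nodes C" by auto
  qed
  then have "finite (edges C)"
    using assms by (meson finite_SigmaI finite_subset is_circuit_def)
  then show ?thesis
    using assms by (auto intro: finite_acyclic_wf_converse simp: is_circuit_def)
qed

lemma evaluates_unique:
  "evaluates C x v b \<Longrightarrow> evaluates C x v b' \<Longrightarrow> b = b'"
proof (induction arbitrary: b' rule: evaluates.induct)
  case (Lit v i b)
  from Lit.prems Lit.hyps show ?case by cases simp_all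
next
  case (Gate v us bs)
  from Gate.prems Gate.hyps obtain bs'
    where bs': "list_all2 (evaluates C x) us bs'" "b' = THR 2 bs'"
    by cases simp_all
  have "bs = bs'"
    using Gate.IH bs'(1) by (simp add: list_all2_conv_all_nth list_eq_iff_nth_eq)
  with bs' show ?case by simp
qed

lemma evaluates_total:
  assumes C: "is_circuit k n C" and "v \<in> nodes C"
  shows "\<exists>b. evaluates C x v b"
  using wf_edges[OF C] assms(2)
proof (induction v rule: wf_induct_rule)
  case (less v)
  show ?case
  proof (cases "label C v")
    case (Lit i b)
    then show ?thesis by (blast intro: evaluates.Lit)
  next
    case (Gate us)
    with C less.prems have us: "set us \<subseteq> nodes C"
      by (fastforce simp: is_circuit_def)
    have "\<forall>u \<in> set us. \<exists>b. evaluates C x u b"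
      using less us Gate by (auto simp: edges_def)
    then obtain g where "\<forall>u \<in> set us. evaluates C x u (g u)"
      by metis
    then have "list_all2 (evaluates C x) us (map g us)"
      by (simp add: list_all2_conv_all_nth)
    with Gate show ?thesis by (blast intro: evaluates.Gate)
  qed
qed

lemma path_lengths_wf:
  assumes C: "is_circuit k n C" and "v \<in> nodes C"
  shows "finite {l. \<exists>w i b. (v, w) \<in> edges C ^^ l \<and> label C w = Lit i b} \<and>
         {l. \<exists>w i b. (v, w) \<in> edges C ^^ l \<and> label C w = Lit i b} \<noteq> {}"
  using wf_edges[OF C] assms(2)
proof (induction v rule: wf_induct_rule)
  case (less v)
  define L where "L v = {l. \<exists>w i b. (v, w) \<in> edges C ^^ l \<and> label C w = Lit i b}" for v
  show ?case
  proof (cases "label C v")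
    case (Lit i b)
    have "l = 0" if "l \<in> L v" for l
    proof (cases l)
      case (Suc m)
      with that obtain w where "(v, w) \<in> edges C ^^ Suc m" by (auto simp: L_def)
      then obtain u where "(v, u) \<in> edges C" by (meson relpow_Suc_D2)
      with Lit show ?thesis by (simp add: edges_def)
    qed simp
    then have "L v \<subseteq> {0}" by auto
    moreover have "0 \<in> L v" using Lit by (auto simp: L_def)
    ultimately have "finite (L v)" "L v \<noteq> {}" by (auto intro: finite_subset)
    then show ?thesis by (simp add: L_def)
  next
    case (Gate us)
    with C less.prems have us: "set us \<subseteq> nodes C" "us \<noteq> []"
      by (fastforce simp: is_circuit_def)+
    have E: "(v, u) \<in> edges C \<longleftrightarrow> u \<in> set us" for u
      using Gate less.prems by (auto simp: edges_def)
    have IH: "finite (L u)" "L u \<noteq> {}" if "u \<in> set us" for u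
      using less.IH[of u] that us E by (auto simp: L_def)
    have "L v \<subseteq> (\<Union>u \<in> set us. Suc ` L u)"
    proof
      fix l assume "l \<in> L v"
      then obtain w i b where w: "(v, w) \<in> edges C ^^ l" "label C w = Lit i b"
        by (auto simp: L_def)
      with Gate obtain m where m: "l = Suc m" by (cases l) auto
      with w obtain u where "(v, u) \<in> edges C" "(u, w) \<in> edges C ^^ m"
        by (meson relpow_Suc_D2)
      with w E have "m \<in> L u" "u \<in> set us" by (auto simp: L_def)
      with m show "l \<in> (\<Union>u \<in> set us. Suc ` L u)" by blast
    qed
    then have "finite (L v)"
      using IH by (auto intro: finite_subset)
    moreover have "L v \<noteq> {}"
    proof -
      from us have u: "hd us \<in> set us" by simp
      with IH obtain m w i b where "(hd us, w) \<in> edges C ^^ m" "label C w = Lit i b"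
        by (force simp: L_def)
      moreover from this u E have "(v, w) \<in> edges C ^^ Suc m" by (meson relpow_Suc_I2)
      ultimately have "Suc m \<in> L v" unfolding L_def by blast
      then show ?thesis by auto
    qed
    ultimately show ?thesis by (simp add: L_def)
  qed
qed

lemma path_lengths_finite_nonempty:
  assumes "is_circuit k n C"
  shows "finite (path_lengths C)" "path_lengths C \<noteq> {}"
  using path_lengths_wf[OF assms, of "out C"] assms
  by (auto simp: path_lengths_def is_circuit_def)


section \<open>Communication protocols\<close>

text \<open>
  A node of the tree stands for the communication so far. At \<open>Step j \<phi> P Q\<close>, party \<open>j\<close> broadcasts
  the bit \<open>\<phi> x\<^sup>j\<close>, and the protocol continues with \<open>P\<close> if the bit is \<open>0\<close> and with \<open>Q\<close> if it is \<open>1\<close>.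
\<close>

datatype protocol =
  Result nat bool
| Step nat "bool list \<Rightarrow> bool" protocol protocol

primrec is_protocol :: "nat \<Rightarrow> nat \<Rightarrow> protocol \<Rightarrow> bool" where
  "is_protocol k n (Result i b) \<longleftrightarrow> i < n"
| "is_protocol k n (Step j \<phi> P Q) \<longleftrightarrow> j < k \<and> is_protocol k n P \<and> is_protocol k n Q"

primrec result :: "protocol \<Rightarrow> (nat \<Rightarrow> bool list) \<Rightarrow> nat \<times> bool" where
  "result (Result i b) xs = (i, b)"
| "result (Step j \<phi> P Q) xs = (if \<phi> (xs j) then result Q xs else result P xs)"

primrec bits :: "protocol \<Rightarrow> (nat \<Rightarrow> bool list) \<Rightarrow> nat" where
  "bits (Result i b) xs = 0"
| "bits (Step j \<phi> P Q) xs = Suc (if \<phi> (xs j) then bits Q xs else bits P xs)"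

definition solves_R_game :: "nat \<Rightarrow> nat \<Rightarrow> (bool list \<Rightarrow> bool) \<Rightarrow> protocol \<Rightarrow> bool" where
  "solves_R_game k n f P \<longleftrightarrow>
     (\<forall>xs \<in> zero_tuples k n f. case result P xs of (i, b) \<Rightarrow> i < n \<and> (\<forall>j<k. xs j ! i = b))"

text \<open>
  The supremum is a maximum over a finite set, and is \<open>0\<close> if \<open>f\<close> has no zeros. The infimum is
  \<open>\<infinity>\<close> if no protocol solves the game, which for \<open>f \<in> R k n\<close> can only happen for \<open>n = 0\<close>.
\<close>

definition CC :: "nat \<Rightarrow> nat \<Rightarrow> (bool list \<Rightarrow> bool) \<Rightarrow> enat" where
  "CC k n f = (INF P \<in> {P. is_protocol k n P \<and> solves_R_game k n f P}.
                 SUP xs \<in> zero_tuples k n f. enat (bits P xs))"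

end

theory Submission
  imports Defs "HOL-Library.Nat_Bijection"
begin

text \<open>
  Circuit to protocol: at a gate that vanishes on all \<open>k\<close> inputs, every party has at most one
  input node of value 1, so one of the \<open>k + 1\<close> input nodes vanishes for all parties; they find it
  with \<open>k (k + 1)\<close> bits and descend to it.

  Protocol to circuit: keep the zeros under consideration divided into at most \<open>k\<close> classes such that
  for every assignment of classes to the parties, the remaining game on the product of the
  assigned classes can be solved with \<open>h\<close> bits. Splitting each class by the answers to the first
  questions of all \<open>k ^ k\<close> assignments lowers \<open>h\<close> by one and leaves a bounded number of classes.
  As long as there are more than \<open>k\<close> of them, a gate applied to the circuits obtained by omitting
  one of \<open>k + 1\<close> fixed classes reduces their number, since a zero is lost in at most one input.
  When \<open>h = 0\<close>, an assignment that uses all nonempty classes yields a literal that vanishes on all of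
  them. Considering all assignments at once is what allows classes to disappear without
  loss of progress.
\<close>

section \<open>Solvable sets of inputs\<close>

text \<open>The game restricted to an arbitrary set \<open>D\<close> of tuples, product or not, so
  that what remains after some answers is again an instance. For
  \<open>D = zero_tuples k n f\<close> this bounds \<open>CC k n f\<close> by
  \<open>h\<close>.\<close>

definition solvable :: "nat \<Rightarrow> nat \<Rightarrow> (nat \<Rightarrow> bool list) set \<Rightarrow> nat \<Rightarrow> bool" where
  "solvable k n D h \<longleftrightarrow> (\<exists>P. is_protocol k n P \<and>
     (\<forall>xs \<in> D. (case result P xs of (i, b) \<Rightarrow> i < n \<and> (\<forall>j<k. xs j ! i = b)) \<and> bits P xs \<le> h))"

lemma solvable_mono:
  "solvable k n D h \<Longrightarrow> D' \<subseteq> D \<Longrightarrow> h \<le> h' \<Longrightarrow> solvable k n D' h'"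
  unfolding solvable_def by (meson order_trans subsetD)

lemma solvable_Result:
  assumes "i < n" "\<And>xs j. xs \<in> D \<Longrightarrow> j < k \<Longrightarrow> xs j ! i = b"
  shows "solvable k n D h"
  unfolding solvable_def using assms by (intro exI[of _ "Result i b"]) auto

lemma solvable_Step:
  assumes "j < k" "solvable k n {xs \<in> D. \<not> \<phi> (xs j)} h" "solvable k n {xs \<in> D. \<phi> (xs j)} h"
  shows "solvable k n D (Suc h)"
proof -
  obtain P where P: "is_protocol k n P"
    "\<And>xs. xs \<in> D \<Longrightarrow> \<not> \<phi> (xs j) \<Longrightarrow>
      (case result P xs of (i, b) \<Rightarrow> i < n \<and> (\<forall>j<k. xs j ! i = b)) \<and> bits P xs \<le> h"
    using assms(2) by (auto simp: solvable_def)
  obtain Q where Q: "is_protocol k n Q"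
    "\<And>xs. xs \<in> D \<Longrightarrow> \<phi> (xs j) \<Longrightarrow>
      (case result Q xs of (i, b) \<Rightarrow> i < n \<and> (\<forall>j<k. xs j ! i = b)) \<and> bits Q xs \<le> h"
    using assms(3) by (auto simp: solvable_def)
  show ?thesis
    unfolding solvable_def
    by (rule exI[of _ "Step j \<phi> P Q"]) (use P Q assms(1) in auto)
qed

lemma solvable_Suc_cases:
  assumes "solvable k n D (Suc h)" "k > 0"
  obtains j \<phi> where "j < k"
    "solvable k n {xs \<in> D. \<not> \<phi> (xs j)} h" "solvable k n {xs \<in> D. \<phi> (xs j)} h"
proof -
  obtain P where P: "is_protocol k n P"
    "\<forall>xs \<in> D. (case result P xs of (i, b) \<Rightarrow> i < n \<and> (\<forall>j<k. xs j ! i = b)) \<and> bits P xs \<le> Suc h"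
    using assms(1) by (auto simp: solvable_def)
  show ?thesis
  proof (cases P)
    case (Result i b)
    then have "solvable k n D h"
      using P by (intro solvable_Result[of i _ _ _ b]) auto
    \<comment> \<open>A protocol that stops at once is padded with a dummy question to party 0: one
      answer leaves \<open>D\<close>, the other the empty set.\<close>
    then show ?thesis
      using assms(2) that[of 0 "\<lambda>_. True"] by (auto intro: solvable_mono)
  next
    case (Step j \<phi> P0 P1)
    have "(case result P0 xs of (i, b) \<Rightarrow> i < n \<and> (\<forall>j<k. xs j ! i = b)) \<and> bits P0 xs \<le> h"
      if "xs \<in> D" "\<not> \<phi> (xs j)" for xs
      using bspec[OF P(2) that(1)] that(2) Step by simp
    then have "solvable k n {xs \<in> D. \<not> \<phi> (xs j)} h"
      unfolding solvable_def using P(1) Step by (intro exI[of _ P0]) simp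
    moreover have "(case result P1 xs of (i, b) \<Rightarrow> i < n \<and> (\<forall>j<k. xs j ! i = b)) \<and> bits P1 xs \<le> h"
      if "xs \<in> D" "\<phi> (xs j)" for xs
      using bspec[OF P(2) that(1)] that(2) Step by simp
    then have "solvable k n {xs \<in> D. \<phi> (xs j)} h"
      unfolding solvable_def using P(1) Step by (intro exI[of _ P1]) simp
    ultimately show ?thesis
      using that[of j \<phi>] P(1) Step by simp
  qed
qed

lemma solvable_0_literal:
  assumes "solvable k n D 0" "D \<noteq> {}"
  obtains i b where "i < n" "\<And>xs j. xs \<in> D \<Longrightarrow> j < k \<Longrightarrow> xs j ! i = b"
proof -
  obtain P where P: "is_protocol k n P"
    "\<forall>xs \<in> D. (case result P xs of (i, b) \<Rightarrow> i < n \<and> (\<forall>j<k. xs j ! i = b)) \<and> bits P xs \<le> 0"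
    using assms(1) by (auto simp: solvable_def)
  then show ?thesis
    using assms(2) that by (cases P) auto
qed

text \<open>One party after another broadcasts \<open>\<phi>\<close> of its own input, one bit each;
  a positive answer ends the round, since the \<open>\<exists>\<close> case is then known to
  hold.\<close>

lemma solvable_ask_all:
  assumes "m \<le> k"
    "solvable k n {xs \<in> D. \<forall>j<m. \<not> \<phi> (xs j)} h" "solvable k n {xs \<in> D. \<exists>j<m. \<phi> (xs j)} h"
  shows "solvable k n D (h + m)"
  using assms
proof (induction m arbitrary: D)
  case 0
  then show ?case by simp
next
  case (Suc m)
  have "solvable k n {xs \<in> D. \<not> \<phi> (xs m)} (h + m)"
  proof (rule Suc.IH)
    show "solvable k n {xs \<in> {xs \<in> D. \<not> \<phi> (xs m)}. \<forall>j<m. \<not> \<phi> (xs j)} h"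
      using Suc.prems(2) by (rule solvable_mono) (auto simp: less_Suc_eq)
    show "solvable k n {xs \<in> {xs \<in> D. \<not> \<phi> (xs m)}. \<exists>j<m. \<phi> (xs j)} h"
      using Suc.prems(3) by (rule solvable_mono) (auto simp: less_Suc_eq)
  qed (use Suc.prems in simp)
  moreover have "solvable k n {xs \<in> D. \<phi> (xs m)} (h + m)"
    using Suc.prems(3) by (rule solvable_mono) auto
  ultimately show ?case
    using Suc.prems(1) solvable_Step[of m k n D \<phi> "h + m"] by simp
qed

text \<open>Candidates are tested in turn. A round of at most \<open>k\<close> bits either confirms
  \<open>u\<close> or rules it out, and then the witness lies among the remaining
  candidates.\<close>

lemma solvable_search:
  assumes "us \<noteq> []"
    "\<And>u. u \<in> set us \<Longrightarrow> solvable k n {xs \<in> D. \<forall>j<k. \<not> \<phi> u (xs j)} h"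
  shows "solvable k n {xs \<in> D. \<exists>u \<in> set us. \<forall>j<k. \<not> \<phi> u (xs j)} (h + k * length us)"
  using assms
proof (induction us rule: list_nonempty_induct)
  case (single u)
  then show ?case by (auto elim: solvable_mono)
next
  case (cons u us)
  let ?E = "{xs \<in> D. \<exists>u \<in> set (u # us). \<forall>j<k. \<not> \<phi> u (xs j)}"
  have "solvable k n {xs \<in> D. \<exists>u \<in> set us. \<forall>j<k. \<not> \<phi> u (xs j)} (h + k * length us)"
    using cons by auto
  then have "solvable k n {xs \<in> ?E. \<exists>j<k. \<phi> u (xs j)} (h + k * length us)"
    by (rule solvable_mono) auto
  moreover have "solvable k n {xs \<in> D. \<forall>j<k. \<not> \<phi> u (xs j)} h"
    using cons.prems by simp
  then have "solvable k n {xs \<in> ?E. \<forall>j<k. \<not> \<phi> u (xs j)} (h + k * length us)"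
    by (rule solvable_mono) auto
  ultimately have "solvable k n ?E (h + k * length us + k)"
    by (intro solvable_ask_all[of k k n _ "\<phi> u"]) auto
  then show ?case by (simp add: algebra_simps)
qed


section \<open>From circuits to protocols\<close>

lemma count_list_ge_2:
  assumes "r < length bs" "s < length bs" "r \<noteq> s" "bs ! r" "bs ! s"
  shows "2 \<le> count_list bs True"
proof -
  have "card {r, s} \<le> card {i. i < length bs \<and> bs ! i}"
    using assms by (intro card_mono) auto
  then show ?thesis
    using assms(3) by (simp add: count_list_eq_length_filter length_filter_conv_card)
qed

text \<open>Pigeonhole: were every input position 1 for some party, two of the \<open>k + 1\<close>
  positions would share one of the \<open>k\<close> parties, and the gate would be 1 for it.
  Positions, not nodes, are counted because a node may feed several inputs.\<close>

lemma common_zero_input: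
  assumes "length us = k + 1" "label C v = Gate us" "\<forall>j<k. evaluates C (xs j) v False"
  shows "\<exists>u \<in> set us. \<forall>j<k. evaluates C (xs j) u False"
proof (rule ccontr)
  assume neg: "\<not> ?thesis"
  have "\<exists>bs. list_all2 (evaluates C (xs j)) us bs \<and> \<not> THR 2 bs" if "j < k" for j
  proof -
    have "evaluates C (xs j) v False" using assms(3) that by blast
    then show ?thesis by cases (use assms(2) in auto)
  qed
  then obtain bs where bs: "\<And>j. j < k \<Longrightarrow> list_all2 (evaluates C (xs j)) us (bs j)"
    "\<And>j. j < k \<Longrightarrow> \<not> THR 2 (bs j)"
    by metis
  have "\<exists>j<k. bs j ! r" if "r < k + 1" for r
  proof -
    have "us ! r \<in> set us" using that assms(1) by simp
    then obtain j where "j < k" "\<not> evaluates C (xs j) (us ! r) False"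
      using neg by blast
    moreover from this have "evaluates C (xs j) (us ! r) (bs j ! r)"
      using bs(1) that assms(1) by (simp add: list_all2_conv_all_nth)
    ultimately show ?thesis by (cases "bs j ! r") auto
  qed
  then obtain p where p: "\<And>r. r < k + 1 \<Longrightarrow> p r < k \<and> bs (p r) ! r"
    by metis
  have "\<not> inj_on p {..<k + 1}"
  proof
    assume "inj_on p {..<k + 1}"
    then have "card {..<k + 1} \<le> card {..<k}"
      using p by (intro card_inj_on_le[of p]) auto
    then show False by simp
  qed
  then obtain r s where rs: "r < k + 1" "s < k + 1" "r \<noteq> s" "p r = p s"
    by (auto simp: inj_on_def)
  have "length (bs (p r)) = k + 1"
    using bs(1)[of "p r"] p rs(1) assms(1) by (auto dest: list_all2_lengthD)
  then have "THR 2 (bs (p r))"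
    unfolding THR_def using rs p[of r] p[of s] by (intro count_list_ge_2[of r _ s]) auto
  then show False using bs(2) p rs(1) by auto
qed

text \<open>Induction on a bound for the path lengths to literals: it drops by one at each child of
  a gate, and finding a child that vanishes for all parties costs \<open>k\<close> bits for each of
  the \<open>k + 1\<close> inputs.\<close>

lemma circuit_node_solvable:
  assumes C: "is_circuit k n C" and "v \<in> nodes C"
    and "\<And>l w i b. (v, w) \<in> edges C ^^ l \<Longrightarrow> label C w = Lit i b \<Longrightarrow> l \<le> d"
  shows "solvable k n {xs. \<forall>j<k. evaluates C (xs j) v False} (k * (k + 1) * d)"
  using assms(2,3)
proof (induction d arbitrary: v)
  case d: (0 v)
  show ?case
  proof (cases "label C v")
    case (Lit i b)
    have "i < n" using C d.prems(1) Lit by (fastforce simp: is_circuit_def)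
    moreover have "x ! i = (\<not> b)" if "evaluates C x v False" for x
      using that by cases (use Lit in auto)
    ultimately show ?thesis by (intro solvable_Result[of i n _ k "\<not> b"]) auto
  next
    case (Gate us)
    have us: "set us \<subseteq> nodes C" "us \<noteq> []"
      using C d.prems(1) Gate by (fastforce simp: is_circuit_def)+
    then have u: "(v, hd us) \<in> edges C" "hd us \<in> nodes C"
      using d.prems(1) Gate by (auto simp: edges_def)
    \<comment> \<open>A gate contradicts the bound 0: below its first input lies some literal, at
      distance at least one from \<open>v\<close>.\<close>
    obtain l w i b where w: "(hd us, w) \<in> edges C ^^ l" "label C w = Lit i b"
      using path_lengths_wf[OF C u(2)] by auto
    show ?thesis
      using d.prems(2)[OF relpow_Suc_I2[OF u(1) w(1)] w(2)] by simp
  qed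
next
  case (Suc d v)
  show ?case
  proof (cases "label C v")
    case (Lit i b)
    have "i < n" using C Suc.prems(1) Lit by (fastforce simp: is_circuit_def)
    moreover have "x ! i = (\<not> b)" if "evaluates C x v False" for x
      using that by cases (use Lit in auto)
    ultimately show ?thesis by (intro solvable_Result[of i n _ k "\<not> b"]) auto
  next
    case (Gate us)
    have us: "set us \<subseteq> nodes C" "length us = k + 1"
      using C Suc.prems(1) Gate by (fastforce simp: is_circuit_def)+
    let ?D = "{xs. \<forall>j<k. evaluates C (xs j) v False}"
    let ?\<phi> = "\<lambda>u x. \<not> evaluates C x u False"
    have "solvable k n {xs \<in> ?D. \<forall>j<k. \<not> ?\<phi> u (xs j)} (k * (k + 1) * d)" if "u \<in> set us" for u
    proof -
      have "(v, u) \<in> edges C" using that Gate Suc.prems(1) by (auto simp: edges_def)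
      then have "solvable k n {xs. \<forall>j<k. evaluates C (xs j) u False} (k * (k + 1) * d)"
      proof (intro Suc.IH)
        show "u \<in> nodes C" using that us by blast
        show "l \<le> d" if "(u, w) \<in> edges C ^^ l" "label C w = Lit i b" for l w i b
          using Suc.prems(2)[OF relpow_Suc_I2[OF \<open>(v, u) \<in> edges C\<close> that(1)] that(2)] by simp
      qed
      then show ?thesis by (rule solvable_mono) auto
    qed
    moreover have "us \<noteq> []" using us by auto
    ultimately have "solvable k n {xs \<in> ?D. \<exists>u \<in> set us. \<forall>j<k. \<not> ?\<phi> u (xs j)}
        (k * (k + 1) * d + k * length us)"
      by (intro solvable_search) auto
    \<comment> \<open>Whenever the gate vanishes for all parties, so does one of its inputs; hence
      the search always succeeds.\<close>
    moreover have "?D \<subseteq> {xs \<in> ?D. \<exists>u \<in> set us. \<forall>j<k. \<not> ?\<phi> u (xs j)}"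
      using common_zero_input[OF us(2) Gate] by auto
    ultimately show ?thesis
      using us(2) by (auto elim!: solvable_mono simp: algebra_simps)
  qed
qed

lemma circuit_solvable:
  assumes "is_circuit k n C" "circuit_le n C f"
  shows "solvable k n (zero_tuples k n f) (k * (k + 1) * depth C)"
proof -
  have "solvable k n {xs. \<forall>j<k. evaluates C (xs j) (out C) False} (k * (k + 1) * depth C)"
  proof (rule circuit_node_solvable[OF assms(1)])
    show "out C \<in> nodes C" using assms(1) by (simp add: is_circuit_def)
  next
    fix l w i b
    assume "(out C, w) \<in> edges C ^^ l" "label C w = Lit i b"
    then show "l \<le> depth C"
      using path_lengths_finite_nonempty[OF assms(1)]
      by (auto simp: depth_def path_lengths_def intro!: Max_ge)
  qed
  moreover have "zero_tuples k n f \<subseteq> {xs. \<forall>j<k. evaluates C (xs j) (out C) False}"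
    using assms(2) by (auto simp: zero_tuples_def circuit_le_def)
  ultimately show ?thesis by (rule solvable_mono) simp
qed


section \<open>Sets on which a shallow circuit vanishes\<close>

text \<open>With \<open>S = zeros n f\<close> this bounds \<open>min_depth k n f\<close> by
  \<open>d\<close>. General sets \<open>S\<close> serve for the unions of classes that arise in the
  recursion.\<close>

definition coverable :: "nat \<Rightarrow> nat \<Rightarrow> nat \<Rightarrow> bool list set \<Rightarrow> bool" where
  "coverable k n d S \<longleftrightarrow>
     (\<exists>C. is_circuit k n C \<and> (\<forall>x \<in> S. evaluates C x (out C) False) \<and> depth C \<le> d)"

lemma coverable_mono:
  "coverable k n d S \<Longrightarrow> S' \<subseteq> S \<Longrightarrow> d \<le> d' \<Longrightarrow> coverable k n d' S'"
  unfolding coverable_def by (meson order_trans subsetD)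

lemma depth_le:
  assumes "is_circuit k n C"
    "\<And>l w i b. (out C, w) \<in> edges C ^^ l \<Longrightarrow> label C w = Lit i b \<Longrightarrow> l \<le> d"
  shows "depth C \<le> d"
  using path_lengths_finite_nonempty[OF assms(1)] assms(2)
  by (auto simp: depth_def path_lengths_def)

lemma coverable_literal:
  assumes "i < n" "\<And>x. x \<in> S \<Longrightarrow> x ! i = b"
  shows "coverable k n d S"
proof -
  \<comment> \<open>The literal has the opposite sign, so that it is 0 where bit \<open>i\<close>
    equals \<open>b\<close>.\<close>
  define C where "C = \<lparr>nodes = {0}, label = (\<lambda>_. Lit i (\<not> b)), out = 0\<rparr>"
  have E: "edges C = {}" by (auto simp: edges_def C_def)
  have C: "is_circuit k n C"
    using assms(1) E by (auto simp: is_circuit_def C_def acyclic_def)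
  moreover have "evaluates C x (out C) False" if "x \<in> S" for x
    using evaluates.Lit[of C 0 i "\<not> b" x] assms(2)[OF that] by (auto simp: C_def)
  moreover have "depth C \<le> d"
  proof (rule depth_le[OF C])
    fix l w
    assume "(out C, w) \<in> edges C ^^ l"
    then show "l \<le> d" using E by (cases l) (auto elim: relpow_Suc_E2)
  qed
  ultimately show ?thesis by (auto simp: coverable_def)
qed

section \<open>Circuits joined by a new output gate\<close>

text \<open>\<open>prod_encode\<close> keeps the copies for different \<open>r\<close> disjoint, and
  \<open>Suc\<close> leaves 0 free for the new gate.\<close>

definition copy :: "nat \<Rightarrow> nat \<Rightarrow> nat" where
  "copy r v = Suc (prod_encode (r, v))"

fun rename :: "(nat \<Rightarrow> nat) \<Rightarrow> node_label \<Rightarrow> node_label" where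
  "rename g (Lit i b) = Lit i b"
| "rename g (Gate us) = Gate (map g us)"

definition join :: "nat \<Rightarrow> (nat \<Rightarrow> circuit) \<Rightarrow> circuit" where
  "join k C = \<lparr>
     nodes = insert 0 (\<Union>r\<le>k. copy r ` nodes (C r)),
     label = (\<lambda>x. if x = 0 then Gate (map (\<lambda>r. copy r (out (C r))) [0..<k + 1])
                  else case prod_decode (x - 1) of (r, v) \<Rightarrow> rename (copy r) (label (C r) v)),
     out = 0\<rparr>"

lemma copy_eq_iff [simp]: "copy r v = copy s u \<longleftrightarrow> r = s \<and> v = u"
  by (auto simp: copy_def)

lemma copy_neq_0 [simp]: "copy r v \<noteq> 0" "0 \<noteq> copy r v"
  by (auto simp: copy_def)

lemma label_join_copy [simp]: "label (join k C) (copy r v) = rename (copy r) (label (C r) v)"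
  by (simp add: join_def copy_def)

lemma label_join_0 [simp]:
  "label (join k C) 0 = Gate (map (\<lambda>r. copy r (out (C r))) [0..<k + 1])"
  by (simp add: join_def)

lemma out_join [simp]: "out (join k C) = 0"
  by (simp add: join_def)

lemma nodes_join: "nodes (join k C) = insert 0 (\<Union>r\<le>k. copy r ` nodes (C r))"
  by (simp add: join_def)

lemma rename_eq_Gate: "rename g l = Gate us \<longleftrightarrow> (\<exists>vs. l = Gate vs \<and> us = map g vs)"
  by (cases l) auto

lemma rename_eq_Lit: "rename g l = Lit i b \<longleftrightarrow> l = Lit i b"
  by (cases l) auto

lemma edges_join_0: "(0, u) \<in> edges (join k C) \<Longrightarrow> \<exists>r\<le>k. u = copy r (out (C r))"
  by (auto simp: edges_def less_Suc_eq_le)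

lemma edges_join_copy:
  "(copy r v, u) \<in> edges (join k C) \<Longrightarrow> r \<le> k \<and> (\<exists>v'. u = copy r v' \<and> (v, v') \<in> edges (C r))"
  by (auto simp: edges_def nodes_join rename_eq_Gate)

text \<open>No edge leaves a copy, so paths starting in one project back to the original circuit.
  Both acyclicity and the depth of the joined circuit rest on this.\<close>

lemma relpow_edges_join_copy:
  "(copy r v, u) \<in> edges (join k C) ^^ l \<Longrightarrow> \<exists>v'. u = copy r v' \<and> (v, v') \<in> edges (C r) ^^ l"
proof (induction l arbitrary: u)
  case 0
  then show ?case by auto
next
  case (Suc l)
  then obtain w where "(copy r v, w) \<in> edges (join k C) ^^ l" "(w, u) \<in> edges (join k C)"
    by auto
  then show ?case using Suc.IH edges_join_copy by fastforce
qed

lemma acyclic_edges_join: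
  assumes "\<And>r. r \<le> k \<Longrightarrow> acyclic (edges (C r))"
  shows "acyclic (edges (join k C))"
proof (rule acyclicI, rule allI, rule notI)
  fix x
  assume x: "(x, x) \<in> (edges (join k C))\<^sup>+"
  then obtain y where y: "(y, x) \<in> edges (join k C)" by (meson tranclD2)
  then have "y \<in> nodes (join k C)" by (simp add: edges_def)
  then have "y = 0 \<or> (\<exists>r v. y = copy r v)" by (auto simp: nodes_join)
  \<comment> \<open>No edge ends at 0, so a node on a cycle lies in a copy, and the cycle projects
    to one in \<open>C r\<close>.\<close>
  then obtain r v where xr: "x = copy r v"
    using y edges_join_0 edges_join_copy by blast
  obtain u where "(x, u) \<in> edges (join k C)" using x by (meson tranclD)
  then have "r \<le> k" using edges_join_copy xr by blast
  obtain l where "l > 0" "(x, x) \<in> edges (join k C) ^^ l" using x by (auto simp: trancl_power)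
  then have "(v, v) \<in> edges (C r) ^^ l"
    using relpow_edges_join_copy[where C = C and r = r and v = v and u = x and l = l] xr by auto
  then have "(v, v) \<in> (edges (C r))\<^sup>+" using \<open>l > 0\<close> by (auto simp: trancl_power)
  then show False using assms[OF \<open>r \<le> k\<close>] by (auto simp: acyclic_def)
qed

lemma is_circuit_join:
  assumes "\<And>r. r \<le> k \<Longrightarrow> is_circuit k n (C r)"
  shows "is_circuit k n (join k C)"
proof -
  have "case label (join k C) w of Lit i b \<Rightarrow> i < n
      | Gate us \<Rightarrow> length us = k + 1 \<and> set us \<subseteq> nodes (join k C)" if w: "w \<in> nodes (join k C)" for w
  proof (cases "w = 0")
    case True
    have "copy r (out (C r)) \<in> nodes (join k C)" if "r \<le> k" for r
      using assms[OF that] that by (force simp: nodes_join is_circuit_def)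
    then show ?thesis using True by (auto simp: less_Suc_eq_le simp del: upt_Suc)
  next
    case False
    then obtain r v where rv: "w = copy r v" "r \<le> k" "v \<in> nodes (C r)"
      using w by (auto simp: nodes_join)
    then show ?thesis
      using assms[of r] by (cases "label (C r) v") (fastforce simp: is_circuit_def nodes_join)+
  qed
  then show ?thesis
    using assms acyclic_edges_join[of k C] by (auto simp: is_circuit_def nodes_join)
qed

lemma evaluates_join_copy:
  "evaluates (C r) x v b \<Longrightarrow> evaluates (join k C) x (copy r v) b"
proof (induction rule: evaluates.induct)
  case (Lit v i b)
  then show ?case by (auto intro: evaluates.Lit)
next
  case (Gate v us bs)
  then show ?case
    by (intro evaluates.Gate[of _ _ "map (copy r) us"]) (auto simp: list_all2_conv_all_nth)
qed

lemma count_list_le_1: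
  assumes "\<And>r s. r < length bs \<Longrightarrow> s < length bs \<Longrightarrow> bs ! r \<Longrightarrow> bs ! s \<Longrightarrow> r = s"
  shows "count_list bs True \<le> 1"
proof -
  have "card {i. i < length bs \<and> bs ! i} \<le> 1"
    using assms by (auto simp: card_le_Suc0_iff_eq)
  then show ?thesis
    by (simp add: count_list_eq_length_filter length_filter_conv_card)
qed

text \<open>A point of \<open>T\<close> is missed by at most one \<open>S r\<close>, so at most one
  of the \<open>k + 1\<close> inputs of the new gate is 1 on it, which is below the threshold
  2.\<close>

lemma coverable_gate:
  assumes cov: "\<And>r. r \<le> k \<Longrightarrow> coverable k n d (S r)"
    and miss: "\<And>x r s. x \<in> T \<Longrightarrow> r \<le> k \<Longrightarrow> s \<le> k \<Longrightarrow> x \<notin> S r \<Longrightarrow> x \<notin> S s \<Longrightarrow> r = s"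
  shows "coverable k n (Suc d) T"
proof -
  obtain C where C: "\<And>r. r \<le> k \<Longrightarrow> is_circuit k n (C r)"
    "\<And>r x. r \<le> k \<Longrightarrow> x \<in> S r \<Longrightarrow> evaluates (C r) x (out (C r)) False"
    "\<And>r. r \<le> k \<Longrightarrow> depth (C r) \<le> d"
    using cov unfolding coverable_def by metis
  have J: "is_circuit k n (join k C)" using C(1) by (rule is_circuit_join)
  moreover have "evaluates (join k C) x 0 False" if x: "x \<in> T" for x
  proof -
    have "\<exists>b. evaluates (C r) x (out (C r)) b" if "r \<le> k" for r
      using evaluates_total[OF C(1)[OF that]] C(1)[OF that] by (auto simp: is_circuit_def)
    then obtain b where b: "\<And>r. r \<le> k \<Longrightarrow> evaluates (C r) x (out (C r)) (b r)"
      by metis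
    have b_miss: "x \<notin> S r" if "r \<le> k" "b r" for r
      using b[OF that(1)] C(2)[OF that(1)] that(2) evaluates_unique by blast
    let ?bs = "map b [0..<k + 1]"
    have "evaluates (join k C) x 0 (THR 2 ?bs)"
      by (rule evaluates.Gate[OF label_join_0])
        (auto simp: list_all2_conv_all_nth simp del: upt_Suc intro!: evaluates_join_copy b)
    moreover have "count_list ?bs True \<le> 1"
      by (rule count_list_le_1)
        (use miss[OF x] b_miss in \<open>auto simp: less_Suc_eq_le simp del: upt_Suc\<close>)
    ultimately show ?thesis by (simp add: THR_def)
  qed
  moreover have "depth (join k C) \<le> Suc d"
  proof (rule depth_le[OF J])
    fix l w i b
    assume w: "(out (join k C), w) \<in> edges (join k C) ^^ l" "label (join k C) w = Lit i b"
    show "l \<le> Suc d"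
    proof (cases l)
      case (Suc m)
      then obtain u where u: "(0, u) \<in> edges (join k C)" "(u, w) \<in> edges (join k C) ^^ m"
        using w by (metis out_join relpow_Suc_D2)
      then obtain r where r: "r \<le> k" "u = copy r (out (C r))"
        using edges_join_0 by blast
      then obtain v where v: "w = copy r v" "(out (C r), v) \<in> edges (C r) ^^ m"
        using relpow_edges_join_copy u by blast
      then have "m \<in> path_lengths (C r)"
        using w(2) by (auto simp: path_lengths_def rename_eq_Lit)
      then have "m \<le> depth (C r)"
        using path_lengths_finite_nonempty[OF C(1)[OF r(1)]] by (simp add: depth_def)
      then show ?thesis using C(3)[OF r(1)] Suc by simp
    qed simp
  qed
  ultimately show ?thesis by (auto simp: coverable_def)
qed


section \<open>From protocols to circuits\<close>

text \<open>An assignment \<open>\<alpha>\<close> may repeat classes, and each one may come with its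
  own protocol, unrelated to those of the others.\<close>

definition tuples_solvable :: "nat \<Rightarrow> nat \<Rightarrow> nat \<Rightarrow> bool list set set \<Rightarrow> bool" where
  "tuples_solvable k n h V \<longleftrightarrow> (\<forall>\<alpha> \<in> {..<k} \<rightarrow>\<^sub>E V. solvable k n (Pi\<^sub>E {..<k} \<alpha>) h)"

lemma tuples_solvable_mono: "tuples_solvable k n h V \<Longrightarrow> W \<subseteq> V \<Longrightarrow> tuples_solvable k n h W"
  unfolding tuples_solvable_def by (auto simp: PiE_def Pi_def subset_iff)

text \<open>Here \<open>m\<close> bounds the excess of classes over \<open>k\<close>. Each level of
  gates lowers it by one, as input \<open>r\<close> of a gate omits the \<open>r\<close>-th of
  \<open>k + 1\<close> fixed classes. The classes may overlap.\<close>

lemma coverable_Union_remove: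
  assumes "\<And>W. W \<subseteq> V \<Longrightarrow> card W \<le> k \<Longrightarrow> coverable k n d (\<Union>W)"
    and "finite V" "card V \<le> k + m"
  shows "coverable k n (d + m) (\<Union>V)"
  using assms
proof (induction m arbitrary: V)
  case 0
  then show ?case by simp
next
  case (Suc m V)
  show ?case
  proof (cases "card V \<le> k")
    case True
    then have "coverable k n d (\<Union>V)" using Suc.prems by blast
    then show ?thesis by (rule coverable_mono) auto
  next
    case False
    then obtain W where W: "W \<subseteq> V" "card W = k + 1"
      by (metis Suc_eq_plus1 not_less_eq_eq obtain_subset_with_card_n)
    then have "finite W" using Suc.prems(2) finite_subset by blast
    then obtain g where g: "bij_betw g {0..<k + 1} W"
      using ex_bij_betw_nat_finite W(2) by metis
    have "coverable k n (d + m) (\<Union>(V - {g r}))" if "r \<le> k" for r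
    proof (rule Suc.IH)
      have "g r \<in> V" using g that W(1) by (auto simp: bij_betw_def)
      then show "card (V - {g r}) \<le> k + m" using Suc.prems by simp
    qed (use Suc.prems in auto)
    moreover have "r = s" if "x \<in> \<Union>V" "r \<le> k" "s \<le> k"
      "x \<notin> \<Union>(V - {g r})" "x \<notin> \<Union>(V - {g s})" for x r s
    proof -
      \<comment> \<open>A point missed by input \<open>r\<close> lies in the class
        \<open>g r\<close> and in no other, which determines \<open>r\<close>.\<close>
      have "g r = g s" using that by blast
      then show ?thesis using g that by (auto simp: bij_betw_def inj_on_def)
    qed
    ultimately have "coverable k n (Suc (d + m)) (\<Union>V)"
      by (rule coverable_gate)
    then show ?thesis by simp
  qed
qed

lemma refine_classes:
  fixes V :: "'a set set" and \<Phi> :: "('a \<Rightarrow> bool) set"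
  assumes "finite V" "finite \<Phi>"
  obtains W where "finite W" "card W \<le> card V * 2 ^ card \<Phi>" "\<Union>W = \<Union>V"
    "\<And>B. B \<in> W \<Longrightarrow> \<exists>A \<in> V. B \<subseteq> A"
    "\<And>B \<phi>. B \<in> W \<Longrightarrow> \<phi> \<in> \<Phi> \<Longrightarrow> (\<forall>x \<in> B. \<phi> x) \<or> (\<forall>x \<in> B. \<not> \<phi> x)"
proof -
  \<comment> \<open>\<open>\<Sigma>\<close> is the set of those predicates in \<open>\<Phi>\<close>
    that hold on the cell, so a class has at most \<open>2 ^ card \<Phi>\<close> cells.\<close>
  define cell where "cell = (\<lambda>(A, \<Sigma>). {x \<in> A. \<forall>\<phi> \<in> \<Phi>. \<phi> x \<longleftrightarrow> \<phi> \<in> \<Sigma>})"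
  define W where "W = cell ` (V \<times> Pow \<Phi>)"
  show ?thesis
  proof
    show "finite W" using assms by (simp add: W_def)
    have "card W \<le> card (V \<times> Pow \<Phi>)"
      using assms unfolding W_def by (intro card_image_le) simp
    then show "card W \<le> card V * 2 ^ card \<Phi>"
      using assms by (simp add: card_cartesian_product card_Pow)
    show "\<Union>W = \<Union>V"
    proof
      show "\<Union>W \<subseteq> \<Union>V" by (auto simp: W_def cell_def)
      show "\<Union>V \<subseteq> \<Union>W"
      proof
        fix x assume "x \<in> \<Union>V"
        then obtain A where "A \<in> V" "x \<in> A" by blast
        then have "x \<in> cell (A, {\<phi> \<in> \<Phi>. \<phi> x})" "(A, {\<phi> \<in> \<Phi>. \<phi> x}) \<in> V \<times> Pow \<Phi>"
          by (auto simp: cell_def)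
        then show "x \<in> \<Union>W" unfolding W_def by blast
      qed
    qed
  qed (auto simp: W_def cell_def)
qed

text \<open>At most \<open>k\<close> classes, each cut by the answers to at most
  \<open>k ^ k\<close> first questions, one for each assignment of classes to the \<open>k\<close>
  parties.\<close>

definition class_bound :: "nat \<Rightarrow> nat" where
  "class_bound k = k * 2 ^ (k ^ k)"

lemma le_class_bound: "k \<le> class_bound k"
  by (simp add: class_bound_def)

lemma tuples_solvable_coverable_0:
  assumes "n > 0" "finite V" "card V \<le> k" "tuples_solvable k n 0 V"
  shows "coverable k n 0 (\<Union>V)"
proof (cases "\<Union>V = {}")
  case True
  show ?thesis unfolding True using assms(1) by (rule coverable_literal) simp
next
  case False
  \<comment> \<open>Empty classes are dropped: a single empty factor would empty the whole product,
    and the protocol would then say nothing about the other classes.\<close>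
  define W where "W = V - {{}}"
  have W: "W \<noteq> {}" "finite W" "\<Union>W = \<Union>V" using False assms(2) by (auto simp: W_def)
  have "card W \<le> card {..<k}"
    using assms(2,3) card_mono[of V W] by (auto simp: W_def)
  then obtain g where g: "inj_on g W" "g ` W \<subseteq> {..<k}"
    using card_le_inj[of W "{..<k}"] W(2) by auto
  \<comment> \<open>The injection \<open>g\<close> gives every class in \<open>W\<close> a party of
    its own; parties left over get an arbitrary class in \<open>W\<close>, so the product stays
    nonempty.\<close>
  define \<alpha> where "\<alpha> = (\<lambda>j \<in> {..<k}. if j \<in> g ` W then inv_into W g j else SOME A. A \<in> W)"
  have \<alpha>W: "\<alpha> \<in> {..<k} \<rightarrow>\<^sub>E W"
    using W(1) by (auto simp: \<alpha>_def inv_into_into some_in_eq)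
  then have "solvable k n (Pi\<^sub>E {..<k} \<alpha>) 0"
    using assms(4) by (auto simp: tuples_solvable_def W_def PiE_def Pi_def)
  moreover have "\<alpha> j \<noteq> {}" if "j < k" for j
    using PiE_mem[OF \<alpha>W, of j] that by (simp add: W_def)
  then have ne: "Pi\<^sub>E {..<k} \<alpha> \<noteq> {}"
    by (auto simp: PiE_eq_empty_iff)
  ultimately obtain i b where ib: "i < n"
    "\<And>xs j. xs \<in> Pi\<^sub>E {..<k} \<alpha> \<Longrightarrow> j < k \<Longrightarrow> xs j ! i = b"
    by (rule solvable_0_literal) blast
  have "x ! i = b" if "x \<in> \<Union>V" for x
  proof -
    have "x \<in> \<Union>W" using that W(3) by simp
    then obtain A where A: "A \<in> W" "x \<in> A" by blast
    then have gA: "g A < k" "\<alpha> (g A) = A" using g by (auto simp: \<alpha>_def)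
    obtain xs where "xs \<in> Pi\<^sub>E {..<k} \<alpha>" using ne by blast
    \<comment> \<open>Any \<open>x\<close> in \<open>A\<close> can take the place of the input of
      party \<open>g A\<close>, so the output \<open>(i, b)\<close> is correct for \<open>x\<close>
      too.\<close>
    then have "xs(g A := x) \<in> Pi\<^sub>E {..<k} \<alpha>" using gA A by (auto simp: PiE_iff extensional_def)
    then show ?thesis using ib(2)[of _ "g A"] gA(1) by fastforce
  qed
  then show ?thesis by (rule coverable_literal[OF ib(1)])
qed

text \<open>An assignment of new classes lies inside one of old classes. The first question for the
  latter has a constant answer on the new class of the party asked, so this bit is known in advance
  and can be saved.\<close>

lemma tuples_solvable_refine:
  assumes "k > 0" "finite V" "card V \<le> k" "tuples_solvable k n (Suc h) V"
  obtains W where "finite W" "card W \<le> class_bound k" "\<Union>W = \<Union>V" "tuples_solvable k n h W"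
proof -
  let ?A = "{..<k} \<rightarrow>\<^sub>E V"
  define asks where "asks \<alpha> j \<phi> \<longleftrightarrow> j < k \<and>
      solvable k n {xs \<in> Pi\<^sub>E {..<k} \<alpha>. \<not> \<phi> (xs j)} h \<and>
      solvable k n {xs \<in> Pi\<^sub>E {..<k} \<alpha>. \<phi> (xs j)} h" for \<alpha> j \<phi>
  have "\<exists>j \<phi>. asks \<alpha> j \<phi>" if "\<alpha> \<in> ?A" for \<alpha>
  proof -
    have "solvable k n (Pi\<^sub>E {..<k} \<alpha>) (Suc h)"
      using assms(4) that by (simp add: tuples_solvable_def)
    then obtain j \<phi> where "j < k"
      "solvable k n {xs \<in> Pi\<^sub>E {..<k} \<alpha>. \<not> \<phi> (xs j)} h"
      "solvable k n {xs \<in> Pi\<^sub>E {..<k} \<alpha>. \<phi> (xs j)} h"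
      using assms(1) by (rule solvable_Suc_cases)
    then have "asks \<alpha> j \<phi>" by (simp add: asks_def)
    then show ?thesis by blast
  qed
  then obtain j \<phi> where "\<And>\<alpha>. \<alpha> \<in> ?A \<Longrightarrow> asks \<alpha> (j \<alpha>) (\<phi> \<alpha>)"
    by metis
  then have j\<phi>: "j \<alpha> < k"
    "solvable k n {xs \<in> Pi\<^sub>E {..<k} \<alpha>. \<not> \<phi> \<alpha> (xs (j \<alpha>))} h"
    "solvable k n {xs \<in> Pi\<^sub>E {..<k} \<alpha>. \<phi> \<alpha> (xs (j \<alpha>))} h" if "\<alpha> \<in> ?A" for \<alpha>
    using that by (simp_all add: asks_def)
  have finA: "finite ?A" using assms(2) by (intro finite_PiE) auto
  have "card (\<phi> ` ?A) \<le> card ?A" using finA by (rule card_image_le)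
  also have "card ?A = card V ^ k" by (simp add: card_PiE)
  also have "\<dots> \<le> k ^ k" using assms(3) by (rule power_mono) simp
  finally have card\<Phi>: "card (\<phi> ` ?A) \<le> k ^ k" .
  obtain W where W: "finite W" "card W \<le> card V * 2 ^ card (\<phi> ` ?A)" "\<Union>W = \<Union>V"
    "\<And>B. B \<in> W \<Longrightarrow> \<exists>A \<in> V. B \<subseteq> A"
    "\<And>B \<psi>. B \<in> W \<Longrightarrow> \<psi> \<in> \<phi> ` ?A \<Longrightarrow> (\<forall>x \<in> B. \<psi> x) \<or> (\<forall>x \<in> B. \<not> \<psi> x)"
    using refine_classes[OF assms(2) finite_imageI[OF finA]] by metis
  obtain p where p: "\<And>B. B \<in> W \<Longrightarrow> p B \<in> V \<and> B \<subseteq> p B" using W(4) by metis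
  have "solvable k n (Pi\<^sub>E {..<k} \<beta>) h" if \<beta>: "\<beta> \<in> {..<k} \<rightarrow>\<^sub>E W" for \<beta>
  proof -
    \<comment> \<open>The assignment of old classes containing those of \<open>\<beta>\<close>; its
      first question determines the continuation.\<close>
    define \<alpha> where "\<alpha> = (\<lambda>i \<in> {..<k}. p (\<beta> i))"
    have \<beta>W: "\<beta> i \<in> W" if "i < k" for i using \<beta> that by auto
    have \<alpha>: "\<alpha> \<in> ?A" using p \<beta>W by (auto simp: \<alpha>_def)
    have sub: "Pi\<^sub>E {..<k} \<beta> \<subseteq> Pi\<^sub>E {..<k} \<alpha>"
      using p \<beta>W by (intro PiE_mono) (auto simp: \<alpha>_def)
    have jk: "j \<alpha> < k" using j\<phi>(1)[OF \<alpha>] .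
    from W(5)[OF \<beta>W[OF jk], of "\<phi> \<alpha>"] \<alpha>
    consider "\<forall>x \<in> \<beta> (j \<alpha>). \<phi> \<alpha> x" | "\<forall>x \<in> \<beta> (j \<alpha>). \<not> \<phi> \<alpha> x" by blast
    then show ?thesis
    proof cases
      case 1
      then have "Pi\<^sub>E {..<k} \<beta> \<subseteq> {xs \<in> Pi\<^sub>E {..<k} \<alpha>. \<phi> \<alpha> (xs (j \<alpha>))}"
        using sub jk by (auto simp: PiE_iff)
      then show ?thesis using j\<phi>(3)[OF \<alpha>] by (auto elim: solvable_mono)
    next
      case 2
      then have "Pi\<^sub>E {..<k} \<beta> \<subseteq> {xs \<in> Pi\<^sub>E {..<k} \<alpha>. \<not> \<phi> \<alpha> (xs (j \<alpha>))}"
        using sub jk by (auto simp: PiE_iff)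
      then show ?thesis using j\<phi>(2)[OF \<alpha>] by (auto elim: solvable_mono)
    qed
  qed
  then have "tuples_solvable k n h W" by (simp add: tuples_solvable_def)
  moreover have "card W \<le> class_bound k"
    using W(2) mult_le_mono[OF assms(3) power_increasing[OF card\<Phi>, of "2::nat"]]
    by (simp add: class_bound_def)
  ultimately show ?thesis using W(1,3) that by blast
qed

text \<open>Each saved bit costs a refinement to at most \<open>class_bound k\<close> classes, and
  then one level of gates for each class beyond \<open>k\<close>.\<close>

lemma tuples_solvable_coverable:
  assumes "k > 0" "n > 0" "finite V" "card V \<le> k" "tuples_solvable k n h V"
  shows "coverable k n (h * class_bound k) (\<Union>V)"
  using assms(3-5)
proof (induction h arbitrary: V)
  case 0
  then show ?case using tuples_solvable_coverable_0 assms(2) by simp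
next
  case (Suc h V)
  obtain W where W: "finite W" "card W \<le> class_bound k" "\<Union>W = \<Union>V" "tuples_solvable k n h W"
    using tuples_solvable_refine[OF assms(1) Suc.prems] by metis
  \<comment> \<open>The induction hypothesis covers every subfamily of at most \<open>k\<close>
    classes of \<open>W\<close>, since \<open>tuples_solvable\<close> passes to subfamilies;
    \<open>class_bound k - k\<close> further levels reach all of \<open>W\<close>.\<close>
  have "coverable k n (h * class_bound k + (class_bound k - k)) (\<Union>W)"
    by (rule coverable_Union_remove)
      (use W le_class_bound[of k] finite_subset in \<open>auto intro!: Suc.IH elim: tuples_solvable_mono\<close>)
  then show ?case using W(3) by (auto elim: coverable_mono)
qed

lemma solvable_coverable_zeros:
  assumes "k > 0" "solvable k n (zero_tuples k n f) h"
  shows "coverable k n (h * class_bound k) (zeros n f)"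
proof -
  \<comment> \<open>Every protocol has a leaf, and the leaf names a coordinate below
    \<open>n\<close>.\<close>
  have "\<exists>i. i < n"
  proof -
    obtain P where "is_protocol k n P" using assms(2) by (auto simp: solvable_def)
    then show ?thesis by (induction P) auto
  qed
  \<comment> \<open>At the start all zeros form a single class, so the only assignment yields the
    original game.\<close>
  moreover have "tuples_solvable k n h {zeros n f}"
    unfolding tuples_solvable_def
  proof
    fix \<alpha> assume "\<alpha> \<in> {..<k} \<rightarrow>\<^sub>E {zeros n f}"
    then have "Pi\<^sub>E {..<k} \<alpha> = zero_tuples k n f"
      unfolding zero_tuples_def by (intro PiE_cong) auto
    then show "solvable k n (Pi\<^sub>E {..<k} \<alpha>) h" using assms(2) by simp
  qed
  ultimately show ?thesis
    using tuples_solvable_coverable[of k n "{zeros n f}" h] assms(1) by auto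
qed


section \<open>Comparison of the complexity measures\<close>

text \<open>A protocol is a finite tree; this makes its cost in \<open>CC\<close> finite.\<close>

lemma bits_bounded: "\<exists>h. \<forall>xs. bits P xs \<le> h"
proof (induction P)
  case (Result i b)
  then show ?case by auto
next
  case (Step j \<phi> P Q)
  then obtain p q where "\<And>xs. bits P xs \<le> p" "\<And>xs. bits Q xs \<le> q" by auto
  then show ?case by (intro exI[of _ "Suc (max p q)"]) (auto simp: le_max_iff_disj)
qed

lemma solvable_imp_CC_le: "solvable k n (zero_tuples k n f) h \<Longrightarrow> CC k n f \<le> enat h"
  unfolding CC_def solvable_def solves_R_game_def
  by (fastforce intro: INF_lower2 SUP_least)

lemma coverable_imp_min_depth_le: "coverable k n d (zeros n f) \<Longrightarrow> min_depth k n f \<le> enat d"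
  unfolding min_depth_def coverable_def circuit_le_def by (fastforce intro: INF_lower2)

text \<open>\<open>enat\<close> is well-ordered, so the infimum over a nonempty set of protocols is
  attained, and by a protocol of finite cost; over the empty set it is
  \<open>\<infinity>\<close>.\<close>

lemma CC_cases:
  obtains "CC k n f = \<infinity>"
  | h where "CC k n f = enat h" "solvable k n (zero_tuples k n f) h"
proof -
  let ?Ps = "{P. is_protocol k n P \<and> solves_R_game k n f P}"
  let ?cost = "\<lambda>P. SUP xs \<in> zero_tuples k n f. enat (bits P xs)"
  show ?thesis
  proof (cases "?Ps = {}")
    case True
    then have "CC k n f = \<infinity>" unfolding CC_def by (simp only:) (simp add: top_enat_def)
    then show ?thesis by (rule that(1))
  next
    case False
    then obtain P0 where "P0 \<in> ?Ps" by blast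
    then have "CC k n f \<in> ?cost ` ?Ps"
      unfolding CC_def by (rule wellorder_InfI[OF imageI])
    then obtain P where P: "P \<in> ?Ps" "CC k n f = ?cost P" by blast
    obtain b where b: "\<And>xs. bits P xs \<le> b" using bits_bounded by blast
    then have "CC k n f \<le> enat b" unfolding P(2) by (intro SUP_least) simp
    then obtain h where h: "CC k n f = enat h" by (cases "CC k n f") auto
    have "bits P xs \<le> h" if "xs \<in> zero_tuples k n f" for xs
      using SUP_upper[OF that, of "\<lambda>xs. enat (bits P xs)"]
      unfolding P(2)[symmetric] h by simp
    then have "solvable k n (zero_tuples k n f) h"
      using P(1) unfolding solvable_def solves_R_game_def by (intro exI[of _ P]) simp
    with h show ?thesis by (rule that(2))
  qed
qed

lemma min_depth_cases:
  obtains "min_depth k n f = \<infinity>"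
  | C where "min_depth k n f = enat (depth C)" "is_circuit k n C" "circuit_le n C f"
proof -
  let ?Cs = "{C. is_circuit k n C \<and> circuit_le n C f}"
  show ?thesis
  proof (cases "?Cs = {}")
    case True
    then have "min_depth k n f = \<infinity>"
      unfolding min_depth_def by (simp only:) (simp add: top_enat_def)
    then show ?thesis by (rule that(1))
  next
    case False
    then obtain C0 where "C0 \<in> ?Cs" by blast
    then have "min_depth k n f \<in> (\<lambda>C. enat (depth C)) ` ?Cs"
      unfolding min_depth_def by (rule wellorder_InfI[OF imageI])
    then show ?thesis using that(2) by blast
  qed
qed

text \<open>The bound is trivial if \<open>CC k n f\<close> is infinite; otherwise \<open>h\<close>
  bits give depth at most \<open>h * class_bound k\<close>.\<close>

lemma min_depth_le_CC:
  assumes "k > 0"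
  shows "ereal (1 / real (class_bound k)) * ereal_of_enat (min_depth k n f)
    \<le> ereal_of_enat (CC k n f)"
proof (cases rule: CC_cases[of k n f])
  case 1
  then show ?thesis by simp
next
  case (2 h)
  have "min_depth k n f \<le> enat (h * class_bound k)"
    using assms 2 by (intro coverable_imp_min_depth_le solvable_coverable_zeros)
  then obtain d where d: "min_depth k n f = enat d" "d \<le> h * class_bound k"
    by (cases "min_depth k n f") auto
  have "real d \<le> real h * real (class_bound k)"
    using d(2) by (metis of_nat_le_iff of_nat_mult)
  moreover have "class_bound k > 0" using assms le_class_bound[of k] by simp
  ultimately show ?thesis using 2 d(1) by (simp add: field_simps)
qed

lemma CC_le_min_depth:
  assumes "k > 0"
  shows "ereal_of_enat (CC k n f) \<le> ereal (real (k * (k + 1))) * ereal_of_enat (min_depth k n f)"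
proof (cases rule: min_depth_cases[of k n f])
  case 1
  \<comment> \<open>In \<open>ereal\<close>, \<open>0 * \<infinity> = 0\<close>, so positivity of
    the factor is what makes the right-hand side infinite.\<close>
  have "real (k * (k + 1)) > 0" using assms by (simp only: of_nat_0_less_iff) simp
  then show ?thesis unfolding 1 by simp
next
  case (2 C)
  then have "CC k n f \<le> enat (k * (k + 1) * depth C)"
    by (intro solvable_imp_CC_le circuit_solvable)
  then have "ereal_of_enat (CC k n f) \<le> ereal_of_enat (enat (k * (k + 1) * depth C))"
    by (simp only: ereal_of_enat_le_iff)
  then show ?thesis using 2(1) by simp
qed

theorem theorem5:
  fixes k :: nat
  assumes "k \<ge> 2"
  shows "\<exists>c1 c2 :: real. c1 > 0 \<and> c2 > 0 \<and>
    (\<forall>n. \<forall>f \<in> R k n.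
       ereal c1 * ereal_of_enat (min_depth k n f) \<le> ereal_of_enat (CC k n f) \<and>
       ereal_of_enat (CC k n f) \<le> ereal c2 * ereal_of_enat (min_depth k n f))"
proof -
  have "k > 0" "class_bound k > 0" using assms le_class_bound[of k] by simp_all
  \<comment> \<open>\<open>c1\<close> is the reciprocal of the depth spent per bit, and
    \<open>c2\<close> the number of bits spent per level of the circuit.\<close>
  then have "1 / real (class_bound k) > 0" "real (k * (k + 1)) > 0"
    by (simp_all only: of_nat_0_less_iff zero_less_divide_1_iff) simp
  then show ?thesis
    using min_depth_le_CC[OF \<open>k > 0\<close>] CC_le_min_depth[OF \<open>k > 0\<close>] by blast
qed

end
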